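(* Let $f_1=\sin\theta\cos\phi$, $f_2=\sin\theta\sin\phi$, $f_3=\cos\theta$ be the first degree spherical harmonics on the unit sphere $S^2\subset\mathbb{R}^3$, let $\mathcal{S}_1=\{Xf_1+Yf_2+Zf_3 : (X,Y,Z)\in\mathbb{R}^3\}$, and identify $F=Xf_1+Yf_2+Zf_3$ with $(X,Y,Z)\in\mathbb{R}^3$. Then the scalar product $$\langle F,F'\rangle=\frac{3}{4\pi}\int_{S^2}FF'\,\sin\theta\,d\theta\,d\phi$$ on $\mathcal{S}_1$ coincides with the Euclidean scalar product: for $F=(X,Y,Z)$ and $F'=(X',Y',Z')$ in $\mathcal{S}_1$, $\langle F,F'\rangle = XX'+YY'+ZZ'$.
   Context: The coordinates $(\theta,\phi)$ on the unit sphere $S^2=\{x^2+y^2+z^2=1\}$ are given by $x=\sin\theta\cos\phi$, $y=\sin\theta\sin\phi$, $z=\cos\theta$, with $\theta\in[0,\pi]$, $\phi\in[0,2\pi)$. *)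

theory Defs
  imports "HOL-Analysis.Analysis"
begin

abbreviation S2 :: "(real ^ 3) set" where
  "S2 \<equiv> sphere 0 1"

definition coord_domain :: "(real \<times> real) set" where
  "coord_domain = {0..pi} \<times> {0..<2 * pi}"

definition spherical :: "real \<times> real \<Rightarrow> real ^ 3" where
  "spherical = (\<lambda>(\<theta>, \<phi>). vector [sin \<theta> * cos \<phi>, sin \<theta> * sin \<phi>, cos \<theta>])"

text \<open>Functions on the sphere are functions on \<open>real ^ 3\<close> that are restricted to
  \<open>S2\<close>, so that equality of functions is equality on the sphere.
  \<open>of_coords g\<close> is the function on the sphere whose expression in the coordinates
  \<open>(\<theta>, \<phi>)\<close> is \<open>g\<close>.  The coordinates of a point are unique except
  at the two poles, where \<open>\<phi>\<close> is arbitrary; \<open>of_coords g\<close> is therefore meaningful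
  for those \<open>g\<close> that do not depend on \<open>\<phi>\<close> at \<open>\<theta> = 0\<close> and
  \<open>\<theta> = pi\<close>, as is the case for the three harmonics below.\<close>

definition of_coords :: "(real \<Rightarrow> real \<Rightarrow> real) \<Rightarrow> real ^ 3 \<Rightarrow> real" where
  "of_coords g = (\<lambda>p\<in>S2.
     case (SOME c. c \<in> coord_domain \<and> spherical c = p) of (\<theta>, \<phi>) \<Rightarrow> g \<theta> \<phi>)"

definition f1 :: "real ^ 3 \<Rightarrow> real" where
  "f1 = of_coords (\<lambda>\<theta> \<phi>. sin \<theta> * cos \<phi>)"

definition f2 :: "real ^ 3 \<Rightarrow> real" where
  "f2 = of_coords (\<lambda>\<theta> \<phi>. sin \<theta> * sin \<phi>)"

definition f3 :: "real ^ 3 \<Rightarrow> real" where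
  "f3 = of_coords (\<lambda>\<theta> \<phi>. cos \<theta>)"

definition harmonic :: "real ^ 3 \<Rightarrow> real ^ 3 \<Rightarrow> real" where
  "harmonic v = (\<lambda>p\<in>S2. v $ 1 * f1 p + v $ 2 * f2 p + v $ 3 * f3 p)"

definition harmonics1 :: "(real ^ 3 \<Rightarrow> real) set" where
  "harmonics1 = {harmonic (vector [X, Y, Z]) |X Y Z. True}"

text \<open>Integrals over the sphere are taken in the coordinates, against the area element
  \<open>sin \<theta> d\<theta> d\<phi>\<close>.\<close>

definition S2_integrable :: "(real ^ 3 \<Rightarrow> real) \<Rightarrow> bool" where
  "S2_integrable h \<longleftrightarrow>
     set_integrable lborel coord_domain (\<lambda>(\<theta>, \<phi>). h (spherical (\<theta>, \<phi>)) * sin \<theta>)"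

definition S2_integral :: "(real ^ 3 \<Rightarrow> real) \<Rightarrow> real" where
  "S2_integral h =
     set_lebesgue_integral lborel coord_domain (\<lambda>(\<theta>, \<phi>). h (spherical (\<theta>, \<phi>)) * sin \<theta>)"

definition S2_inner :: "(real ^ 3 \<Rightarrow> real) \<Rightarrow> (real ^ 3 \<Rightarrow> real) \<Rightarrow> real" where
  "S2_inner F F' = 3 / (4 * pi) * S2_integral (\<lambda>p. F p * F' p)"

end

theory Submission
  imports Defs
begin

text \<open>Since a function built by \<^const>\<open>of_coords\<close> from a component of \<^const>\<open>spherical\<close>
  returns that component, \<open>harmonic v\<close> is the linear form \<open>p \<mapsto> v \<bullet> p\<close> at every point given
  in coordinates.  Hence \<open>\<langle>F, F'\<rangle>\<close> is, up to the factor \<open>3 / (4 * pi)\<close>, the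
  bilinear form whose matrix consists of the second moments of the area measure, and the claim amounts to saying that this matrix is
  \<open>4 * pi / 3\<close> times the identity: lemma \<open>second_moments\<close>.  In coordinates each second moment
  is the integral of a function of \<open>\<theta>\<close> times a function of \<open>\<phi>\<close>, so Fubini's theorem (lemma
  \<open>has_bochner_integral_pair_mult\<close>) reduces it to two elementary one-dimensional integrals.

  Injectivity of \<^const>\<open>harmonic\<close> then comes for free: a harmonic determines its inner
  products with all other harmonics, hence all the numbers \<open>v \<bullet> u\<close>, and these determine
  \<open>v\<close>.\<close>

lemma has_bochner_integral_pair_mult:
  fixes f :: "'a \<Rightarrow> real" and g :: "'b \<Rightarrow> real"
  assumes "sigma_finite_measure M" "sigma_finite_measure N"
    and f: "has_bochner_integral M f I" and g: "has_bochner_integral N g J"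
  shows "has_bochner_integral (M \<Otimes>\<^sub>M N) (\<lambda>(x, y). f x * g y) (I * J)"
proof -
  interpret pair_sigma_finite M N
    using assms by (simp add: pair_sigma_finite_def)
  have int_fg: "integrable M f" "integrable N g"
    and [simp]: "integral\<^sup>L M f = I" "integral\<^sup>L N g = J"
    using f g by (auto simp: has_bochner_integral_iff)
  have [measurable]: "f \<in> borel_measurable M" "g \<in> borel_measurable N"
    using int_fg by (auto intro: borel_measurable_integrable)
  have int: "integrable (M \<Otimes>\<^sub>M N) (\<lambda>(x, y). f x * g y)"
    by (rule Fubini_integrable) (use int_fg in \<open>auto simp: abs_mult\<close>)
  have "integral\<^sup>L (M \<Otimes>\<^sub>M N) (\<lambda>(x, y). f x * g y) = (\<integral>x. (\<integral>y. f x * g y \<partial>N) \<partial>M)"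
    using integral_fst'[OF int] by simp
  also have "\<dots> = I * J"
    by simp
  finally show ?thesis
    using int by (simp add: has_bochner_integral_iff)
qed

section \<open>The harmonics as linear forms\<close>

lemma spherical_nth [simp]:
  "spherical (\<theta>, \<phi>) $ 1 = sin \<theta> * cos \<phi>"
  "spherical (\<theta>, \<phi>) $ 2 = sin \<theta> * sin \<phi>"
  "spherical (\<theta>, \<phi>) $ 3 = cos \<theta>"
  by (simp_all add: spherical_def)

lemma spherical_in_S2: "spherical c \<in> S2"
proof (cases c)
  case (Pair \<theta> \<phi>)
  have "spherical c \<bullet> spherical c = (sin \<theta>)\<^sup>2 * ((sin \<phi>)\<^sup>2 + (cos \<phi>)\<^sup>2) + (cos \<theta>)\<^sup>2"
    unfolding Pair inner_vec_def sum_3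
    by (simp add: power2_eq_square algebra_simps del: sin_cos_squared_add sin_cos_squared_add3)
  then show ?thesis
    by (simp add: norm_eq_1)
qed

text \<open>Distinct coordinates of the same point (at a pole) give the same value, because that
  value is a component of the point; so the choice made by \<^const>\<open>of_coords\<close> is
  harmless.\<close>

lemma of_coords_spherical:
  assumes "c \<in> coord_domain" and g: "\<And>\<theta> \<phi>. g \<theta> \<phi> = spherical (\<theta>, \<phi>) $ i"
  shows "of_coords g (spherical c) = spherical c $ i"
proof -
  let ?c = "SOME c'. c' \<in> coord_domain \<and> spherical c' = spherical c"
  have "?c \<in> coord_domain \<and> spherical ?c = spherical c"
    by (rule someI[of _ c]) (use assms in simp)
  then show ?thesis
    by (auto simp: of_coords_def spherical_in_S2[simplified] g split: prod.split)
qed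

lemma harmonic_spherical:
  assumes "c \<in> coord_domain"
  shows "harmonic v (spherical c) = v \<bullet> spherical c"
proof -
  have "f1 (spherical c) = spherical c $ 1" "f2 (spherical c) = spherical c $ 2"
    "f3 (spherical c) = spherical c $ 3"
    unfolding f1_def f2_def f3_def
    by (rule of_coords_spherical[OF assms]; simp)+
  then show ?thesis
    using spherical_in_S2[of c] by (simp add: harmonic_def inner_vec_def sum_3)
qed

section \<open>Second moments of the area measure\<close>

lemma has_bochner_integral_colatitude:
  fixes F :: "real \<Rightarrow> real"
  assumes "\<And>x. (F has_real_derivative f x) (at x)" "continuous_on UNIV f"
    and "F pi - F 0 = I"
  shows "has_bochner_integral lborel (\<lambda>x. f x * indicator {0..pi} x) I"
  using has_bochner_integral_FTC_Icc_real[of 0 pi F f] assms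
  by (auto simp: continuous_on_eq_continuous_at)

lemma has_bochner_integral_longitude:
  fixes F :: "real \<Rightarrow> real"
  assumes "\<And>x. (F has_real_derivative f x) (at x)" and cont: "continuous_on UNIV f"
    and "F (2 * pi) - F 0 = I"
  shows "has_bochner_integral lborel (\<lambda>x. f x * indicator {0..<2 * pi} x) I"
proof -
  have [measurable]: "f \<in> borel_measurable borel"
    using cont by (rule borel_measurable_continuous_onI)
  \<comment> \<open>The fundamental theorem of calculus gives the integral over the closed interval; its
    additional endpoint is a null set.\<close>
  have closed: "has_bochner_integral lborel (\<lambda>x. f x * indicator {0..2 * pi} x) I"
    using has_bochner_integral_FTC_Icc_real[of 0 "2 * pi" F f] assms
    by (auto simp: continuous_on_eq_continuous_at)
  have ae: "AE x in lborel. f x * indicator {0..2 * pi} x = f x * indicator {0..<2 * pi} x"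
    using AE_lborel_singleton[of "2 * pi"] by eventually_elim (auto simp: indicator_def)
  show ?thesis
    using closed by (subst has_bochner_integral_cong_AE[OF _ _ ae, symmetric]) simp_all
qed

lemma has_bochner_integral_coord_domain:
  assumes "has_bochner_integral lborel (\<lambda>x. f x * indicator {0..pi} x) I"
    and "has_bochner_integral lborel (\<lambda>x. g x * indicator {0..<2 * pi} x) J"
    and "\<And>\<theta> \<phi>. h (\<theta>, \<phi>) = f \<theta> * g \<phi>" and "I * J = K"
  shows "has_bochner_integral lborel (\<lambda>c. indicator coord_domain c * h c :: real) K"
proof -
  have "(\<lambda>c. indicator coord_domain c * h c) =
      (\<lambda>(x, y). (f x * indicator {0..pi} x) * (g y * indicator {0..<2 * pi} y))"
    using assms(3) by (auto simp: coord_domain_def indicator_def fun_eq_iff)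
  then show ?thesis
    using has_bochner_integral_pair_mult[OF _ _ assms(1,2)] assms(4)
    by (simp add: lborel_prod lborel.sigma_finite_measure_axioms)
qed

text \<open>The \<open>\<phi>\<close>-integral vanishes in every mixed moment.  The three diagonal moments are
  \<open>4/3 * pi\<close>, \<open>4/3 * pi\<close> and \<open>2/3 * 2 * pi\<close>: they agree, as they must, since some
  rotations permute the axes, and they add up to the area \<open>4 * pi\<close>.\<close>

lemma second_moments:
  "has_bochner_integral lborel
     (\<lambda>c. indicator coord_domain c * (spherical c $ i * spherical c $ j * sin (fst c)))
     (if i = j then 4 * pi / 3 else 0)"
proof -
  note deriv = derivative_eq_intros
  note moment = has_bochner_integral_coord_domain
  have sin3: "has_bochner_integral lborel (\<lambda>x. sin x ^ 3 * indicator {0..pi} x) (4 / 3)"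
  proof (rule has_bochner_integral_colatitude)
    fix x :: real
    have s2: "(sin x)\<^sup>2 = 1 - (cos x)\<^sup>2"
      by (simp add: sin_squared_eq)
    have "sin x ^ 3 = sin x * (1 - (cos x)\<^sup>2)"
      unfolding s2[symmetric] by (simp add: power3_eq_cube power2_eq_square)
    then show "((\<lambda>x. cos x ^ 3 / 3 - cos x) has_real_derivative sin x ^ 3) (at x)"
      by (auto intro!: deriv simp: algebra_simps)
  qed (auto intro!: continuous_intros)
  have sin2_cos: "has_bochner_integral lborel
      (\<lambda>x. (sin x)\<^sup>2 * cos x * indicator {0..pi} x) 0"
    by (rule has_bochner_integral_colatitude[where F = "\<lambda>x. sin x ^ 3 / 3"])
      (auto intro!: deriv continuous_intros)
  have cos2_sin: "has_bochner_integral lborel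
      (\<lambda>x. (cos x)\<^sup>2 * sin x * indicator {0..pi} x) (2 / 3)"
    by (rule has_bochner_integral_colatitude[where F = "\<lambda>x. - (cos x ^ 3 / 3)"])
      (auto intro!: deriv continuous_intros)
  have one: "has_bochner_integral lborel (\<lambda>x. 1 * indicator {0..<2 * pi} x) (2 * pi)"
    by (rule has_bochner_integral_longitude[where F = "\<lambda>x. x"]) (auto intro!: deriv)
  have cos: "has_bochner_integral lborel (\<lambda>x. cos x * indicator {0..<2 * pi} x) 0"
    by (rule has_bochner_integral_longitude[where F = sin]) (auto intro!: deriv continuous_intros)
  have sin: "has_bochner_integral lborel (\<lambda>x. sin x * indicator {0..<2 * pi} x) 0"
    by (rule has_bochner_integral_longitude[where F = "\<lambda>x. - cos x"])
      (auto intro!: deriv continuous_intros)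
  have cos2: "has_bochner_integral lborel (\<lambda>x. (cos x)\<^sup>2 * indicator {0..<2 * pi} x) pi"
    by (rule has_bochner_integral_longitude[where F = "\<lambda>x. (x + sin x * cos x) / 2"])
      (auto intro!: deriv continuous_intros simp: power2_eq_square[symmetric] sin_squared_eq)
  have sin2: "has_bochner_integral lborel (\<lambda>x. (sin x)\<^sup>2 * indicator {0..<2 * pi} x) pi"
    by (rule has_bochner_integral_longitude[where F = "\<lambda>x. (x - sin x * cos x) / 2"])
      (auto intro!: deriv continuous_intros simp: power2_eq_square[symmetric] cos_squared_eq)
  have sin_cos: "has_bochner_integral lborel
      (\<lambda>x. sin x * cos x * indicator {0..<2 * pi} x) 0"
    by (rule has_bochner_integral_longitude[where F = "\<lambda>x. (sin x)\<^sup>2 / 2"])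
      (auto intro!: deriv continuous_intros)
  let ?P = "\<lambda>(i :: 3) (j :: 3) K. has_bochner_integral lborel
    (\<lambda>c. indicator coord_domain c * (spherical c $ i * spherical c $ j * sin (fst c))) K"
  have sym: "?P j i K" if "?P i j K" for i j K
    using that by (simp add: mult.commute[of "spherical _ $ i"])
  have "?P 1 1 (4 * pi / 3)"
    by (rule moment[OF sin3 cos2]) (simp_all add: power2_eq_square power3_eq_cube)
  moreover have "?P 1 2 0"
    by (rule moment[OF sin3 sin_cos]) (simp_all add: power3_eq_cube)
  moreover have "?P 1 3 0"
    by (rule moment[OF sin2_cos cos]) (simp_all add: power2_eq_square)
  moreover have "?P 2 2 (4 * pi / 3)"
    by (rule moment[OF sin3 sin2]) (simp_all add: power2_eq_square power3_eq_cube)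
  moreover have "?P 2 3 0"
    by (rule moment[OF sin2_cos sin]) (simp_all add: power2_eq_square)
  moreover have "?P 3 3 (4 * pi / 3)"
    by (rule moment[OF cos2_sin one]) (simp_all add: power2_eq_square)
  ultimately have "\<forall>i j. ?P i j (if i = j then 4 * pi / 3 else 0)"
    using sym[of 1 2 0] sym[of 1 3 0] sym[of 2 3 0] unfolding forall_3 by simp
  then show ?thesis
    by blast
qed

section \<open>The scalar product\<close>

lemma harmonic_product_integral:
  "has_bochner_integral lborel
     (\<lambda>c. indicator coord_domain c *\<^sub>R
        (case c of (\<theta>, \<phi>) \<Rightarrow> harmonic v (spherical (\<theta>, \<phi>)) * harmonic w (spherical (\<theta>, \<phi>)) * sin \<theta>))
     (4 * pi / 3 * (v \<bullet> w))"
proof -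
  have "has_bochner_integral lborel
      (\<lambda>c. \<Sum>i\<in>UNIV. \<Sum>j\<in>UNIV. v $ i * w $ j *
         (indicator coord_domain c * (spherical c $ i * spherical c $ j * sin (fst c))))
      (\<Sum>i\<in>UNIV. \<Sum>j\<in>UNIV. v $ i * w $ j * (if i = j then 4 * pi / 3 else 0))"
    by (intro has_bochner_integral_sum has_bochner_integral_mult_right second_moments)
  moreover have "(v \<bullet> p) * (w \<bullet> p) * t =
      (\<Sum>i\<in>UNIV. \<Sum>j\<in>UNIV. v $ i * w $ j * (p $ i * p $ j * t))" for p t
    unfolding inner_vec_def sum_product sum_distrib_right
    by (simp add: sum_distrib_left mult_ac)
  then have "(\<lambda>c. \<Sum>i\<in>UNIV. \<Sum>j\<in>UNIV. v $ i * w $ j *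
         (indicator coord_domain c * (spherical c $ i * spherical c $ j * sin (fst c)))) =
      (\<lambda>c. indicator coord_domain c *\<^sub>R (case c of (\<theta>, \<phi>) \<Rightarrow>
         harmonic v (spherical (\<theta>, \<phi>)) * harmonic w (spherical (\<theta>, \<phi>)) * sin \<theta>))"
    by (auto simp: fun_eq_iff indicator_def harmonic_spherical)
  moreover have "(\<Sum>i\<in>UNIV. \<Sum>j\<in>UNIV. v $ i * w $ j * (if i = j then 4 * pi / 3 else 0)) =
      4 * pi / 3 * (v \<bullet> w)"
    by (simp add: if_distrib[of "(*) _"] inner_vec_def sum_distrib_left algebra_simps cong: if_cong)
  ultimately show ?thesis
    by simp
qed

lemma S2_integrable_harmonic_product: "S2_integrable (\<lambda>p. harmonic v p * harmonic w p)"
  using harmonic_product_integral[of v w]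
  by (simp add: S2_integrable_def set_integrable_def has_bochner_integral_iff)

lemma S2_inner_harmonic: "S2_inner (harmonic v) (harmonic w) = v \<bullet> w"
  using harmonic_product_integral[of v w]
  by (simp add: S2_inner_def S2_integral_def set_lebesgue_integral_def has_bochner_integral_iff
      field_simps)

text \<open>The right-hand side of \<open>S2_inner_harmonic\<close> is nondegenerate, so the left-hand side
  cannot identify two different coefficient vectors.\<close>

lemma inj_harmonic: "inj harmonic"
proof (rule injI)
  fix v w :: "real ^ 3"
  assume "harmonic v = harmonic w"
  then have "v \<bullet> u = w \<bullet> u" for u
    by (metis S2_inner_harmonic)
  then show "v = w"
    using vector_eq_rdot by blast
qed

lemma harmonics1_eq_range: "harmonics1 = range harmonic"
proof -
  have "harmonic v = harmonic (vector [v $ 1, v $ 2, v $ 3])" for v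
    by (rule arg_cong[where f = harmonic]) (simp add: vec_eq_iff forall_3)
  then have "harmonic v \<in> harmonics1" for v
    unfolding harmonics1_def by blast
  then show ?thesis
    unfolding harmonics1_def by blast
qed

theorem proposition1p1:
  shows "bij_betw harmonic UNIV harmonics1 \<and>
    (\<forall>F\<in>harmonics1. \<forall>F'\<in>harmonics1. S2_integrable (\<lambda>p. F p * F' p)) \<and>
    (\<forall>X Y Z X' Y' Z' :: real.
       S2_inner (harmonic (vector [X, Y, Z])) (harmonic (vector [X', Y', Z'])) =
       X * X' + Y * Y' + Z * Z') \<and>
    (\<forall>v w. S2_inner (harmonic v) (harmonic w) = v \<bullet> w)"
  using inj_harmonic
  by (auto simp: bij_betw_def harmonics1_eq_range S2_integrable_harmonic_product
      S2_inner_harmonic inner_vec_def sum_3)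

end
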